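(* Let $S$ be a commutative cancellative semigroup and $H$ a commutative group. Let $G=S-S$ be a natural extension of $S$. Assume that multiplication by $m!$ is bijective on $H$. Let $f:S\to H$ be a polynomial function of degree at most $m$. Then there exists a unique polynomial function $F:G\to H$ of degree at most $m$ such that $F_{|S}=f$.
   Context: A semigroup $(S,+)$ is a set with an associative binary operation (no identity required); it is cancellative if $a+c=b+c$ implies $a=b$ for all $a,b,c\in S$. A natural extension of a commutative cancellative semigroup $S$ is a commutative group $G$ containing $S$ as a subsemigroup and such that $G=S-S=\{x-y:x,y\in S\}$. For a commutative semigroup $T$ (in particular a commutative group), a commutative group $H$, $h\in T$ and $f:T\to H$, put $(\Delta_h f)(x)=f(x+h)-f(x)$. For an integer $m\ge 0$, $f:T\to H$ is a polynomial function of degree at most $m$ if $\Delta_{h_1}\Delta_{h_2}\cdots\Delta_{h_{m+1}}f(x)=0$ for all $h_1,\dots,h_{m+1},x\in T$. Multiplication by $m!$ on $H$ is the map $y\mapsto m!\,y$. *)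

theory Defs
  imports Complex_Main
begin

definition diff_op :: "'t::ab_semigroup_add \<Rightarrow> ('t \<Rightarrow> 'h::ab_group_add) \<Rightarrow> 't \<Rightarrow> 'h" where
  "diff_op h f = (\<lambda>x. f (x + h) - f x)"

definition poly_fun :: "nat \<Rightarrow> ('t::ab_semigroup_add \<Rightarrow> 'h::ab_group_add) \<Rightarrow> bool" where
  "poly_fun m f \<longleftrightarrow> (\<forall>hs x. length hs = m + 1 \<longrightarrow> foldr diff_op hs f x = 0)"

definition nat_mult :: "nat \<Rightarrow> 'h::ab_group_add \<Rightarrow> 'h" where
  "nat_mult n y = ((+) y ^^ n) 0"

(* The inclusion of the semigroup in the group is an injective additive map e between
   two types; S - S is the set of differences of elements of its range. *)
definition natural_extension :: "('s::ab_semigroup_add \<Rightarrow> 'g::ab_group_add) \<Rightarrow> bool" where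
  "natural_extension e \<longleftrightarrow>
     inj e \<and> (\<forall>x y. e (x + y) = e x + e y) \<and> (UNIV :: 'g set) = {e x - e y | x y. True}"

end

theory Submission
  imports Defs
begin

text \<open>
  Write \<open>E\<^sub>t\<close> for the shift \<open>f \<mapsto> (\<lambda>x. f (x + t))\<close>, so that \<open>E\<^sub>t = 1 + \<Delta>\<^sub>t\<close>. On functions of degree at
  most \<open>m\<close> the operator \<open>\<Delta>\<^sub>t\<close> is nilpotent, \<open>\<Delta>\<^sub>t\<^bsup>m+1\<^esup> = 0\<close>, hence \<open>E\<^sub>t\<close> is invertible there, with inverse
  the finite geometric series \<open>\<Sum>i\<le>m. (- \<Delta>\<^sub>t)\<^sup>i\<close>, called \<open>unshift m t\<close> below. This inverse makes sense on
  the semigroup itself, where \<open>- t\<close> is not available.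

  Uniqueness: if \<open>F\<close> is a polynomial function on the group, then \<open>F (s - t)\<close> is the value at \<open>s\<close> of
  \<open>unshift m t F\<close>, and this involves only values of \<open>F\<close> on the semigroup.

  Existence: the same formula defines the extension, \<open>F (s - t) = unshift m t f s\<close>. It is independent of the
  representation \<open>s - t\<close> because unshifts are two-sided inverses of shifts and shifts commute
  (lemma \<open>unshift_cong_difference\<close>). On each translate \<open>S - t\<close> the function \<open>F\<close> is a copy of the
  polynomial function \<open>unshift m t f\<close>, so the iterated differences of \<open>F\<close> with steps in the semigroup vanish; and
  \<open>\<Delta>\<^bsub>a - t\<^esub> = E\<^bsub>- t\<^esub> (\<Delta>\<^sub>a - \<Delta>\<^sub>t)\<close> reduces arbitrary steps to those
  (lemma \<open>poly_fun_if_generator_steps\<close>).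
\<close>

section \<open>Polynomial functions on a commutative semigroup\<close>

text \<open>The next two lemmas describe the degree recursively: every later induction on it uses this
  description, so that lists of steps seldom appear.\<close>

lemma poly_fun_0: "poly_fun 0 f \<longleftrightarrow> (\<forall>x h. f (x + h) = f x)"
proof -
  have "poly_fun 0 f \<longleftrightarrow> (\<forall>h x. foldr diff_op [h] f x = 0)"
    unfolding poly_fun_def
  proof (intro iffI allI impI)
    fix hs :: "'a list" and x
    assume "\<forall>h x. foldr diff_op [h] f x = 0" "length hs = 0 + 1"
    then show "foldr diff_op hs f x = 0"
      by (cases hs) auto
  next
    fix h x
    assume "\<forall>hs x. length hs = 0 + 1 \<longrightarrow> foldr diff_op hs f x = 0"
    then show "foldr diff_op [h] f x = 0"
      by (metis One_nat_def add_0 length_Cons list.size(3))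
  qed
  then show ?thesis
    by (auto simp: diff_op_def)
qed

lemma poly_fun_Suc: "poly_fun (Suc m) f \<longleftrightarrow> (\<forall>h. poly_fun m (diff_op h f))"
proof
  assume f: "poly_fun (Suc m) f"
  show "\<forall>h. poly_fun m (diff_op h f)"
    unfolding poly_fun_def
  proof (intro allI impI)
    fix h x and hs :: "'a list"
    assume "length hs = m + 1"
    then have "length (hs @ [h]) = Suc m + 1"
      by simp
    then have "foldr diff_op (hs @ [h]) f x = 0"
      using f unfolding poly_fun_def by blast
    then show "foldr diff_op hs (diff_op h f) x = 0"
      by simp
  qed
next
  assume diff: "\<forall>h. poly_fun m (diff_op h f)"
  show "poly_fun (Suc m) f"
    unfolding poly_fun_def
  proof (intro allI impI)
    fix x and hs :: "'a list"
    assume "length hs = Suc m + 1"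
    then obtain ks h where "hs = ks @ [h]" "length ks = m + 1"
      by (cases hs rule: rev_cases) auto
    then show "foldr diff_op hs f x = 0"
      using diff by (simp add: poly_fun_def)
  qed
qed

lemma poly_fun_diff_op: "poly_fun m f \<Longrightarrow> poly_fun m (diff_op h f)"
proof (induction m arbitrary: f h)
  case 0
  then show ?case by (simp add: poly_fun_0 diff_op_def)
next
  case (Suc m)
  then show ?case by (simp add: poly_fun_Suc)
qed

lemma poly_fun_diff:
  "poly_fun m f \<Longrightarrow> poly_fun m g \<Longrightarrow> poly_fun m (\<lambda>x. f x - g x)"
proof (induction m arbitrary: f g)
  case 0
  then show ?case by (simp add: poly_fun_0)
next
  case (Suc m)
  have "diff_op h (\<lambda>x. f x - g x) = (\<lambda>x. diff_op h f x - diff_op h g x)" for h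
    by (auto simp: diff_op_def algebra_simps)
  with Suc show ?case by (simp add: poly_fun_Suc)
qed

lemma diff_op_shift: "diff_op h (\<lambda>x. f (x + a)) = (\<lambda>x. diff_op h f (x + a))"
  by (auto simp: diff_op_def ac_simps)

lemma poly_fun_shift: "poly_fun m f \<Longrightarrow> poly_fun m (\<lambda>x. f (x + a))"
proof (induction m arbitrary: f)
  case 0
  then show ?case by (simp add: poly_fun_0)
next
  case (Suc m)
  then show ?case by (simp add: poly_fun_Suc diff_op_shift)
qed

section \<open>Inverting a shift without subtraction\<close>

text \<open>The geometric series \<open>\<Sum>i\<le>m. (- \<Delta>\<^sub>t)\<^sup>i\<close> in Horner form, which avoids signed multiples in the
  commutative group of values.\<close>

fun unshift :: "nat \<Rightarrow> 't::ab_semigroup_add \<Rightarrow> ('t \<Rightarrow> 'h::ab_group_add) \<Rightarrow> 't \<Rightarrow> 'h" where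
  "unshift 0 t f = f"
| "unshift (Suc m) t f = (\<lambda>x. f x - unshift m t (diff_op t f) x)"

lemma poly_fun_unshift: "poly_fun k f \<Longrightarrow> poly_fun k (unshift m t f)"
  by (induction m arbitrary: f) (simp_all add: poly_fun_diff poly_fun_diff_op)

text \<open>Here the degree bound enters: the series telescopes against \<open>1 + \<Delta>\<^sub>t\<close>, and the leftover term is an
  \<open>(m + 1)\<close>-fold difference.\<close>

lemma unshift_apply_shifted: "poly_fun m f \<Longrightarrow> unshift m t f (x + t) = f x"
proof (induction m arbitrary: f)
  case 0
  then show ?case by (simp add: poly_fun_0)
next
  case (Suc m)
  then have "unshift m t (diff_op t f) (x + t) = diff_op t f x"
    by (simp add: poly_fun_Suc)
  then show ?case by (simp add: diff_op_def)
qed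

lemma unshift_shift: "unshift m t (\<lambda>x. f (x + a)) = (\<lambda>x. unshift m t f (x + a))"
  by (induction m arbitrary: f) (simp_all add: diff_op_shift)

text \<open>Since the unshift commutes with shifts, it is also a left inverse; so a polynomial function is
  determined by its values on any translate of the semigroup.\<close>

lemma poly_fun_eqI_shift:
  assumes "poly_fun m f" "poly_fun m g" and eq: "\<And>x. f (x + t) = g (x + t)"
  shows "f = g"
proof
  fix x
  have "f x = unshift m t (\<lambda>y. f (y + t)) x"
    using assms(1) by (simp add: unshift_shift unshift_apply_shifted)
  also have "\<dots> = unshift m t (\<lambda>y. g (y + t)) x"
    by (simp add: eq)
  also have "\<dots> = g x"
    using assms(2) by (simp add: unshift_shift unshift_apply_shifted)
  finally show "f x = g x" .
qed

text \<open>The equation \<open>s + t' = s' + t\<close> says that \<open>s - t\<close> and \<open>s' - t'\<close> are the same difference. Unshifting once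
  more moves both sides to this common point, where the two double unshifts of \<open>f\<close> agree because both
  return to \<open>f\<close> after a shift by \<open>t + t'\<close>.\<close>

lemma unshift_cong_difference:
  assumes f: "poly_fun m f" and eq: "s + t' = s' + t"
  shows "unshift m t f s = unshift m t' f s'"
proof -
  let ?g = "unshift m t f" and ?g' = "unshift m t' f"
  have g: "poly_fun m ?g" and g': "poly_fun m ?g'"
    using f by (simp_all add: poly_fun_unshift)
  have "unshift m t' ?g = unshift m t ?g'"
  proof (rule poly_fun_eqI_shift[where m = m])
    fix x
    have "unshift m t' ?g ((x + t) + t') = f x"
      using f g by (simp add: unshift_apply_shifted)
    moreover have "unshift m t ?g' ((x + t') + t) = f x"
      using f g' by (simp add: unshift_apply_shifted)
    ultimately show "unshift m t' ?g (x + (t + t')) = unshift m t ?g' (x + (t + t'))"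
      by (simp add: ac_simps)
  qed (use g g' in \<open>simp_all add: poly_fun_unshift\<close>)
  moreover have "unshift m t' ?g (s + t') = ?g s" "unshift m t ?g' (s' + t) = ?g' s'"
    using g g' by (simp_all add: unshift_apply_shifted)
  ultimately show ?thesis
    using eq by simp
qed

section \<open>Passing between the semigroup and the group\<close>

lemma unshift_comp_additive:
  assumes "\<And>x y. e (x + y) = e x + e y"
  shows "unshift m (e t) F (e s) = unshift m t (\<lambda>x. F (e x)) s"
proof (induction m arbitrary: F)
  case 0
  show ?case by simp
next
  case (Suc m)
  have "diff_op t (\<lambda>x. F (e x)) = (\<lambda>x. diff_op (e t) F (e x))"
    by (simp add: diff_op_def assms)
  with Suc show ?case by simp
qed

text \<open>The offset \<open>b\<close> will be \<open>- e t\<close>: on the translate of the semigroup by \<open>- t\<close> the extension is a copy of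
  an unshift of the given function.\<close>

lemma foldr_diff_op_additive:
  fixes e :: "'s::ab_semigroup_add \<Rightarrow> 'g::ab_semigroup_add"
  assumes "\<And>x y. e (x + y) = e x + e y" and "\<And>s. F (e s + b) = f s"
  shows "foldr diff_op (map e cs) F (e s + b) = foldr diff_op cs f s"
proof (induction cs arbitrary: s)
  case Nil
  then show ?case by (simp add: assms)
next
  case (Cons c cs)
  have "e s + b + e c = e (s + c) + b"
    by (simp add: assms ac_simps)
  with Cons show ?case
    by (simp add: diff_op_def)
qed

text \<open>A difference with step \<open>e a - e t\<close> is the difference of the two differences with steps \<open>e a\<close> and
  \<open>e t\<close>, translated by \<open>- e t\<close>.\<close>

lemma poly_fun_if_generator_steps:
  fixes e :: "'s \<Rightarrow> 'g::ab_group_add"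
  assumes "UNIV = {e x - e y | x y. True}"
    and "\<And>cs x. length cs = m + 1 \<Longrightarrow> foldr diff_op (map e cs) F x = 0"
  shows "poly_fun m F"
  using assms(2)
proof (induction m arbitrary: F)
  case 0
  have gen: "F (x + e c) = F x" for x c
    using 0[of "[c]" x] by (simp add: diff_op_def)
  have "F (x + h) = F x" for x h
  proof -
    obtain a t where h: "h = e a - e t"
      using assms(1) by blast
    show ?thesis
      using gen[of "x - e t" a] gen[of "x - e t" t] by (simp add: h algebra_simps)
  qed
  then show ?case
    by (simp add: poly_fun_0)
next
  case (Suc m)
  have gen: "poly_fun m (diff_op (e c) F)" for c
  proof (rule Suc.IH)
    fix cs x
    assume "length (cs :: 's list) = m + 1"
    then show "foldr diff_op (map e cs) (diff_op (e c) F) x = 0"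
      using Suc.prems[of "cs @ [c]" x] by simp
  qed
  have "poly_fun m (diff_op h F)" for h
  proof -
    obtain a t where h: "h = e a - e t"
      using assms(1) by blast
    have "diff_op h F = (\<lambda>x. diff_op (e a) F (x + - e t) - diff_op (e t) F (x + - e t))"
      by (simp add: diff_op_def h algebra_simps)
    then show ?thesis
      by (simp only: poly_fun_diff poly_fun_shift gen)
  qed
  then show ?case
    by (simp add: poly_fun_Suc)
qed

section \<open>Unique extension to the group of differences\<close>

theorem corollary6:
  fixes e :: "'s::{ab_semigroup_add, cancel_semigroup_add} \<Rightarrow> 'g::ab_group_add"
    and f :: "'s \<Rightarrow> 'h::ab_group_add"
    and m :: nat
  assumes "natural_extension e"
    and "bij (nat_mult (fact m) :: 'h \<Rightarrow> 'h)"
    and "poly_fun m f"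
  shows "\<exists>!F :: 'g \<Rightarrow> 'h. poly_fun m F \<and> (\<forall>s. F (e s) = f s)"
proof -
  have inj: "inj e" and add: "\<And>x y. e (x + y) = e x + e y"
    and differences: "UNIV = {e x - e y | x y. True}"
    using assms(1) unfolding natural_extension_def by auto
  have "\<forall>x. \<exists>p. x = e (fst p) - e (snd p)"
    using differences by force
  then obtain p where p: "\<And>x. x = e (fst (p x)) - e (snd (p x))"
    by metis
  define F where "F x = unshift m (snd (p x)) f (fst (p x))" for x
  have F: "F (e s + - e t) = unshift m t f s" for s t
  proof -
    let ?s = "fst (p (e s + - e t))" and ?t = "snd (p (e s + - e t))"
    have "e s - e t = e ?s - e ?t"
      using p[of "e s + - e t"] by simp
    then have "e (?s + t) = e (s + ?t)"
      by (simp add: add algebra_simps)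
    then have "?s + t = s + ?t"
      using inj by (simp add: inj_eq)
    then show ?thesis
      unfolding F_def using assms(3) by (rule unshift_cong_difference[rotated])
  qed
  have "poly_fun m F"
  proof (rule poly_fun_if_generator_steps[OF differences])
    fix cs x
    assume len: "length (cs :: 's list) = m + 1"
    obtain s t where x: "x = e s + - e t"
      using p[of x] by auto
    have "foldr diff_op (map e cs) F x = foldr diff_op cs (unshift m t f) s"
      unfolding x using add F by (rule foldr_diff_op_additive)
    also have "\<dots> = 0"
      using poly_fun_unshift[OF assms(3)] len by (simp add: poly_fun_def)
    finally show "foldr diff_op (map e cs) F x = 0" .
  qed
  moreover have "F (e s) = f s" for s
  proof -
    \<comment> \<open>The semigroup need not contain \<open>0\<close>, so \<open>s\<close> is written as \<open>(s + s) - s\<close>.\<close>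
    have "F (e s) = F (e (s + s) + - e s)"
      by (simp add: add)
    also have "\<dots> = f s"
      unfolding F using assms(3) by (rule unshift_apply_shifted)
    finally show ?thesis .
  qed
  moreover have "F' = F" if F': "poly_fun m F'" "\<forall>s. F' (e s) = f s" for F'
  proof
    fix x
    obtain s t where x: "x = e s + - e t"
      using p[of x] by auto
    have "F' x = unshift m (e t) F' (x + e t)"
      using F'(1) by (simp add: unshift_apply_shifted)
    also have "\<dots> = unshift m (e t) F' (e s)"
      by (simp add: x)
    also have "\<dots> = unshift m t f s"
      using F'(2) by (simp add: unshift_comp_additive[OF add])
    finally show "F' x = F x"
      by (simp only: x F)
  qed
  ultimately show ?thesis
    by blast
qed

end
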